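(* Let $q$ be a prime power and $m,n$ positive integers. If $0\le r,s\le n$, $\mathbf{c}_1,\mathbf{c}_2,\mathbf{c}'_1,\mathbf{c}'_2\in\mathrm{GF}(q^m)^n$ and $d_R(\mathbf{c}_1,\mathbf{c}_2)>d_R(\mathbf{c}'_1,\mathbf{c}'_2)$, then $$|B_r(\mathbf{c}_1)\cap B_s(\mathbf{c}_2)|\le |B_r(\mathbf{c}'_1)\cap B_s(\mathbf{c}'_2)|.$$
   Context: For $\mathbf{x}\in \mathrm{GF}(q^m)^n$, $\mathrm{rk}(\mathbf{x})$ is the maximum number of coordinates of $\mathbf{x}$ that are linearly independent over $\mathrm{GF}(q)$; the rank distance is $d_R(\mathbf{x},\mathbf{y})=\mathrm{rk}(\mathbf{x}-\mathbf{y})$; $B_r(\mathbf{x})$ is the set of all vectors in $\mathrm{GF}(q^m)^n$ within rank distance $r$ of $\mathbf{x}$. *)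

theory Defs
  imports "HOL-Analysis.Finite_Cartesian_Product" "HOL-Number_Theory.Prime_Powers"
begin

definition field_embedding :: "('k::field \<Rightarrow> 'a::field) \<Rightarrow> bool" where
  "field_embedding \<iota> \<longleftrightarrow>
     \<iota> 1 = 1 \<and> (\<forall>x y. \<iota> (x + y) = \<iota> x + \<iota> y) \<and> (\<forall>x y. \<iota> (x * y) = \<iota> x * \<iota> y)"

text \<open>
  The small field is a type of its own, embedded by \<open>\<iota>\<close>, so that the extension field is a
  vector space over it with scalar multiplication \<open>\<lambda>k v. \<iota> k * v\<close>. Linear independence of the
  coordinates with indices in \<open>I\<close> is meant as a family. Library independence is a property
  of sets, hence the injectivity condition: two equal coordinates are dependent.
\<close>

definition coords_independent :: "('k::field \<Rightarrow> 'a::field) \<Rightarrow> 'a ^ 'n \<Rightarrow> 'n set \<Rightarrow> bool" where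
  "coords_independent \<iota> x I \<longleftrightarrow>
     inj_on (($) x) I \<and> \<not> module.dependent (\<lambda>k v. \<iota> k * v) (($) x ` I)"

definition rk :: "('k::field \<Rightarrow> 'a::field) \<Rightarrow> 'a ^ 'n \<Rightarrow> nat" where
  "rk \<iota> x = Max {card I | I. coords_independent \<iota> x I}"

definition rank_dist :: "('k::field \<Rightarrow> 'a::field) \<Rightarrow> 'a ^ 'n \<Rightarrow> 'a ^ 'n \<Rightarrow> nat" where
  "rank_dist \<iota> x y = rk \<iota> (x - y)"

definition rank_ball :: "('k::field \<Rightarrow> 'a::field) \<Rightarrow> nat \<Rightarrow> 'a ^ 'n \<Rightarrow> ('a ^ 'n) set" where
  "rank_ball \<iota> r x = {y. rank_dist \<iota> x y \<le> r}"

end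

theory Submission
  imports Defs
begin

text \<open>
  Translating the centres to \<open>0\<close> and \<open>c\<close>, the task is to see how the size of
  \<open>{x. rk x \<le> r \<and> rk (x - c) \<le> s}\<close> depends on \<open>c\<close>. If all coordinates of \<open>x\<close> but the \<open>k\<close>-th
  are fixed, then each of the two conditions on the \<open>k\<close>-th coordinate describes the empty set, the
  whole field, or a coset of a subspace, and \<open>c $ k\<close> only shifts one coset relative to the other.
  An intersection of two cosets is empty or has the size of the intersection of the subspaces, so
  replacing \<open>c $ k\<close> by \<open>0\<close> cannot decrease the count. Zeroing coordinates brings \<open>c\<close> to a
  vector with the right number of independent entries and zeros elsewhere, which a rank-preserving
  linear map takes to the other given vector.
\<close>

section \<open>Counting over fibres and permuting a finite index set\<close>

lemma card_le_fibrewise: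
  fixes h :: "'b \<Rightarrow> 'c"
  assumes "finite A" "finite B"
    and le: "\<And>y. card {x\<in>A. h x = y} \<le> card {x\<in>B. h x = y}"
  shows "card A \<le> card B"
proof -
  \<comment> \<open>Values from both sets are collected so that one index set serves both sums;
    empty fibres contribute 0.\<close>
  let ?H = "h ` (A \<union> B)"
  have fibres: "card S = (\<Sum>y\<in>?H. card {x\<in>S. h x = y})" if "S \<subseteq> A \<union> B" for S
  proof -
    have "finite S"
      using that assms finite_subset by auto
    then have "(\<Sum>y\<in>?H. sum (\<lambda>_. 1) {x\<in>S. h x = y}) = sum (\<lambda>_. 1::nat) S"
      using that assms by (intro sum.group) auto
    then show ?thesis
      by simp
  qed
  show ?thesis
    unfolding fibres[of A, simplified] fibres[of B, simplified] by (intro sum_mono le)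
qed

text \<open>The complements of \<open>I\<close> and \<open>J\<close> also have equal size, so a
  bijection between them can be glued to one from \<open>I\<close> to \<open>J\<close>. A
  permutation of all indices is wanted in order to permute coordinates injectively.\<close>

lemma bij_image_eq_if_card_eq:
  fixes I J :: "'n::finite set"
  assumes "card I = card J"
  obtains \<sigma> where "bij \<sigma>" "\<sigma> ` I = J"
proof -
  obtain f where f: "bij_betw f I J"
    using assms finite_same_card_bij finite by metis
  have "card (- I) = card (- J)"
    using assms by (simp add: Compl_eq_Diff_UNIV card_Diff_subset)
  then obtain g where g: "bij_betw g (- I) (- J)"
    using finite_same_card_bij finite by metis
  let ?h = "\<lambda>i. if i \<in> I then f i else g i"
  have hI: "bij_betw ?h I J"
    using f by (simp cong: bij_betw_cong)
  moreover have "bij_betw ?h (- I) (- J)"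
    using g by (subst bij_betw_cong[of _ _ g]) auto
  ultimately have "bij_betw ?h (I \<union> - I) (J \<union> - J)"
    by (rule bij_betw_combine) auto
  then have "bij ?h"
    by (simp only: Compl_partition)
  then show thesis
    using bij_betw_imp_surj_on[OF hI] by (rule that)
qed

definition zero_outside :: "'n set \<Rightarrow> 'a::zero ^ 'n \<Rightarrow> 'a ^ 'n" where
  "zero_outside J c = (\<chi> i. if i \<in> J then c $ i else 0)"

lemma zero_outside_nth [simp]: "zero_outside J c $ i = (if i \<in> J then c $ i else 0)"
  by (simp add: zero_outside_def)

section \<open>Rank as the dimension of the span of the coordinates\<close>

locale finite_field_extension =
  fixes \<iota> :: "'k::field \<Rightarrow> 'a::{field,finite}"
  assumes embedding: "field_embedding \<iota>"
begin

lemma vector_space_scale: "vector_space (\<lambda>k v. \<iota> k * v)"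
  using embedding unfolding field_embedding_def
  by unfold_locales (auto simp: algebra_simps)

sublocale vs: vector_space "\<lambda>k v. \<iota> k * v"
  by (rule vector_space_scale)

sublocale vs: finite_dimensional_vector_space "\<lambda>k v. \<iota> k * v" "vs.extend_basis {}"
  by unfold_locales
    (simp_all add: vs.independent_extend_basis vs.span_extend_basis vs.independent_empty)

lemma independent_coords_subset:
  fixes x :: "'a ^ 'n"
  obtains I where "coords_independent \<iota> x I" "card I = vs.dim (range (($) x))"
    "range (($) x) \<subseteq> vs.span (($) x ` I)"
proof -
  obtain B where B: "B \<subseteq> range (($) x)" "vs.independent B" "range (($) x) \<subseteq> vs.span B"
    "card B = vs.dim (range (($) x))"
    using vs.basis_exists by blast
  obtain I where "inj_on (($) x) I" "B = ($) x ` I"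
    using B(1) unfolding subset_image_inj by blast
  then show thesis
    using B that[of I] by (auto simp: coords_independent_def card_image)
qed

lemma rk_eq_dim: "rk \<iota> (x :: 'a ^ 'n) = vs.dim (range (($) x))"
  unfolding rk_def
proof (rule Max_eqI)
  show "finite {card I |I. coords_independent \<iota> x I}"
    by simp
  show "c \<le> vs.dim (range (($) x))" if c: "c \<in> {card I |I. coords_independent \<iota> x I}" for c
  proof -
    obtain I where I: "c = card I" "inj_on (($) x) I" "vs.independent (($) x ` I)"
      using c by (auto simp: coords_independent_def)
    then have "c = card (($) x ` I)"
      by (simp add: card_image)
    also have "\<dots> \<le> vs.dim (range (($) x))"
      using I by (intro vs.independent_card_le_dim) auto
    finally show ?thesis .
  qed
  show "vs.dim (range (($) x)) \<in> {card I |I. coords_independent \<iota> x I}"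
    using independent_coords_subset[of x] by (metis (mono_tags, lifting) mem_Collect_eq)
qed

lemma rk_mono_span: "range (($) x) \<subseteq> vs.span (range (($) y)) \<Longrightarrow> rk \<iota> x \<le> rk \<iota> y"
  unfolding rk_eq_dim by (rule vs.dim_mono)

text \<open>If \<open>t\<close> and \<open>u\<close> both lie in the span of \<open>Y\<close>, so
  does \<open>t - u\<close>. Otherwise one hypothesis already says that the dimension of
  \<open>Y\<close> plus 1 is at most \<open>r\<close>, which bounds the insertion of any
  element.\<close>

lemma dim_insert_diff_le:
  assumes "vs.dim (insert t Y) \<le> r" "vs.dim (insert u Y) \<le> r"
  shows "vs.dim (insert (t - u) Y) \<le> r"
  using assms vs.span_diff[of t Y u] by (auto simp: vs.dim_insert split: if_splits)

text \<open>With the other entries fixed, the admissible \<open>k\<close>-th entries are closed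
  under subtraction. This is the form in which the coset structure enters the count.\<close>

lemma rk_diff_coord_le:
  fixes x y z :: "'a ^ 'n"
  assumes "rk \<iota> x \<le> r" "rk \<iota> y \<le> r"
    and "\<And>i. i \<noteq> k \<Longrightarrow> y $ i = x $ i" "\<And>i. i \<noteq> k \<Longrightarrow> z $ i = x $ i" "z $ k = x $ k - y $ k"
  shows "rk \<iota> z \<le> r"
proof -
  have range: "range (($) w) = insert (w $ k) (($) x ` (- {k}))"
    if "\<And>i. i \<noteq> k \<Longrightarrow> w $ i = x $ i" for w :: "'a ^ 'n"
  proof -
    have "range (($) w) = insert (w $ k) (($) w ` (- {k}))"
      by (metis Compl_insert Diff_UNIV Compl_empty_eq image_insert insert_Diff UNIV_I Compl_eq_Diff_UNIV)
    also have "($) w ` (- {k}) = ($) x ` (- {k})"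
      using that by (intro image_cong) auto
    finally show ?thesis .
  qed
  have "range (($) y) = insert (y $ k) (($) x ` (- {k}))"
    "range (($) z) = insert (x $ k - y $ k) (($) x ` (- {k}))"
    using range[of y, OF assms(3)] range[of z, OF assms(4)] assms(5) by simp_all
  with assms(1,2) range[of x, OF refl] show ?thesis
    by (metis rk_eq_dim dim_insert_diff_le)
qed

section \<open>Intersections of balls around 0 and \<open>c\<close>, and zeroing entries of
  \<open>c\<close>\<close>

definition ball_inter :: "nat \<Rightarrow> nat \<Rightarrow> 'a ^ 'n \<Rightarrow> ('a ^ 'n) set" where
  "ball_inter r s c = {x. rk \<iota> x \<le> r \<and> rk \<iota> (x - c) \<le> s}"

lemma card_rank_balls_inter:
  "card (rank_ball \<iota> r c1 \<inter> rank_ball \<iota> s c2) = card (ball_inter r s (c1 - c2))"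
proof (rule bij_betw_same_card)
  have *: "x - (c1 - c2) = c2 - (c1 - x)" for x
    by simp
  \<comment> \<open>The reflection in \<open>c1\<close>, unlike a translation, reproduces the
    differences \<open>c1 - y\<close> and \<open>c2 - y\<close> with their signs.\<close>
  show "bij_betw (\<lambda>y. c1 - y) (rank_ball \<iota> r c1 \<inter> rank_ball \<iota> s c2) (ball_inter r s (c1 - c2))"
    by (rule bij_betw_byWitness[where f' = "\<lambda>x. c1 - x"])
      (auto simp: rank_ball_def rank_dist_def ball_inter_def *)
qed

lemma card_ball_inter_zero_coord:
  fixes c :: "'a ^ 'n"
  shows "card (ball_inter r s c) \<le> card (ball_inter r s (zero_outside (- {k}) c))"
proof (rule card_le_fibrewise[where h = "zero_outside (- {k})"])
  fix y :: "'a ^ 'n"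
  let ?F = "\<lambda>c. {x \<in> ball_inter r s c. zero_outside (- {k}) x = y}"
  show "card (?F c) \<le> card (?F (zero_outside (- {k}) c))"
  proof (cases "?F c = {}")
    case False
    then obtain x0 where x0: "x0 \<in> ?F c"
      by blast
    have x0_nth: "x0 $ i = y $ i" if "i \<noteq> k" for i
      using x0 that by (auto simp: vec_eq_iff split: if_splits)
    have "y $ k = 0"
      using x0 by auto
    \<comment> \<open>Off \<open>k\<close> the vectors \<open>x\<close>, \<open>x0\<close> and
      \<open>y\<close> agree, so only the \<open>k\<close>-th entry changes, to
      \<open>x $ k - x0 $ k\<close>. This is also the difference of the \<open>k\<close>-th entries
      of \<open>x - c\<close> and \<open>x0 - c\<close>: the entry \<open>c $ k\<close>
      cancels.\<close>
    have "x - x0 + y \<in> ?F (zero_outside (- {k}) c)" if x: "x \<in> ?F c" for x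
    proof -
      have x_nth: "x $ i = y $ i" if "i \<noteq> k" for i
        using x that by (auto simp: vec_eq_iff split: if_splits)
      have rk: "rk \<iota> x \<le> r" "rk \<iota> x0 \<le> r" "rk \<iota> (x - c) \<le> s" "rk \<iota> (x0 - c) \<le> s"
        using x x0 by (simp_all add: ball_inter_def)
      have "rk \<iota> (x - x0 + y) \<le> r"
        by (rule rk_diff_coord_le[OF rk(1,2), of k]) (simp_all add: x_nth x0_nth \<open>y $ k = 0\<close>)
      moreover have "rk \<iota> (x - x0 + y - zero_outside (- {k}) c) \<le> s"
        by (rule rk_diff_coord_le[OF rk(3,4), of k]) (simp_all add: x_nth x0_nth \<open>y $ k = 0\<close>)
      moreover have "zero_outside (- {k}) (x - x0 + y) = y"
        by (simp add: vec_eq_iff x_nth x0_nth \<open>y $ k = 0\<close>)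
      ultimately show ?thesis
        by (simp add: ball_inter_def)
    qed
    then show ?thesis
      by (intro card_inj_on_le[where f = "\<lambda>x. x - x0 + y"]) (auto simp: inj_on_def)
  next
    case True
    show ?thesis
      unfolding True by simp
  qed
qed auto

lemma card_ball_inter_zero_outside:
  fixes c :: "'a ^ 'n"
  shows "card (ball_inter r s c) \<le> card (ball_inter r s (zero_outside J c))"
proof -
  have "card (ball_inter r s c) \<le> card (ball_inter r s (zero_outside (- K) c))" for K
  proof (induction K rule: infinite_finite_induct)
    case empty
    then show ?case
      by (simp add: zero_outside_def)
  next
    case (insert k K)
    have "zero_outside (- {k}) (zero_outside (- K) c) = zero_outside (- insert k K) c"
      by (auto simp: vec_eq_iff)
    then show ?case
      using insert.IH card_ball_inter_zero_coord[of r s "zero_outside (- K) c" k] by simp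
  qed simp
  from this[of "- J"] show ?thesis
    by simp
qed

section \<open>Injective additive maps that do not raise the rank\<close>

lemma card_ball_inter_le_image:
  fixes c :: "'a ^ 'n"
  assumes "inj T" and diff: "\<And>x y. T (x - y) = T x - T y" and rk: "\<And>x. rk \<iota> (T x) \<le> rk \<iota> x"
  shows "card (ball_inter r s c) \<le> card (ball_inter r s (T c))"
proof (rule card_inj_on_le)
  show "inj_on T (ball_inter r s c)"
    using \<open>inj T\<close> by (rule inj_on_subset) simp
  have "T x \<in> ball_inter r s (T c)" if "x \<in> ball_inter r s c" for x
    using that rk[of x] rk[of "x - c"] by (simp add: ball_inter_def diff)
  then show "T ` ball_inter r s c \<subseteq> ball_inter r s (T c)"
    by blast
qed simp

lemma card_ball_inter_independent_coords:
  fixes c c' :: "'a ^ 'n"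
  assumes I: "coords_independent \<iota> c I" and J: "coords_independent \<iota> c' J"
    and card: "card I = card J"
  shows "card (ball_inter r s (zero_outside I c)) \<le> card (ball_inter r s (zero_outside J c'))"
proof -
  obtain \<sigma> where \<sigma>: "bij \<sigma>" "\<sigma> ` J = I"
    using bij_image_eq_if_card_eq[OF card[symmetric]] .
  have inj_c: "inj_on (($) c) I" and inj_c': "inj_on (($) c') J"
    and ind: "vs.independent (($) c ` I)" "vs.independent (($) c' ` J)"
    using I J by (auto simp: coords_independent_def)
  \<comment> \<open>On the independent entries of \<open>c\<close>, a value determines its index in
    \<open>I\<close>; \<open>inv \<sigma>\<close> carries that index to \<open>J\<close>, where the
    entry of \<open>c'\<close> is read off.\<close>
  define f where "f v = c' $ inv \<sigma> (the_inv_into I (($) c) v)" for v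
  have f: "f (c $ \<sigma> j) = c' $ j" if "j \<in> J" for j
    proof -
    have "\<sigma> j \<in> I"
      using that \<sigma>(2) by blast
    then show ?thesis
      using \<sigma>(1) by (simp add: f_def the_inv_into_f_f[OF inj_c] bij_is_inj)
  qed
  have f_image: "f ` ($) c ` I = ($) c' ` J"
    unfolding \<sigma>(2)[symmetric] image_image using f by (rule image_cong[OF refl])
  \<comment> \<open>By counting: \<open>f\<close> maps a set of size \<open>card I\<close> onto one
    of size \<open>card J\<close>. Injectivity on the independent set lets the linear extension be
    chosen injective.\<close>
  have "inj_on f (($) c ` I)"
    using f_image inj_c inj_c' card by (intro eq_card_imp_inj_on) (auto simp: card_image)
  then obtain \<phi> where lin: "Vector_Spaces.linear (\<lambda>k v. \<iota> k * v) (\<lambda>k v. \<iota> k * v) \<phi>"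
    and "inj \<phi>" and \<phi>: "\<And>v. v \<in> ($) c ` I \<Longrightarrow> \<phi> v = f v"
    using vs.linear_independent_extend_inj[of "($) c ` I" f] ind f_image by metis
  interpret \<phi>: Vector_Spaces.linear "\<lambda>k v. \<iota> k * v" "\<lambda>k v. \<iota> k * v" \<phi>
    by (rule lin)
  interpret pair: finite_dimensional_vector_space_pair_1 "\<lambda>k v. \<iota> k * v" "vs.extend_basis {}"
    "\<lambda>k v. \<iota> k * v" ..
  define T where "T x = (\<chi> j. \<phi> (x $ \<sigma> j))" for x :: "'a ^ 'n"
  have "inj T"
  proof (rule injI)
    fix x y assume "T x = T y"
    then have "x $ \<sigma> j = y $ \<sigma> j" for j
      using \<open>inj \<phi>\<close> by (auto simp: T_def vec_eq_iff inj_eq)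
    then show "x = y"
      using \<sigma>(1) by (metis vec_eq_iff bij_pointE)
  qed
  moreover have "rk \<iota> (T x) \<le> rk \<iota> x" for x
  proof -
    have "range (($) (T x)) \<subseteq> \<phi> ` range (($) x)"
      by (auto simp: T_def)
    then have "vs.dim (range (($) (T x))) \<le> vs.dim (\<phi> ` range (($) x))"
      by (rule vs.dim_subset)
    also have "\<dots> \<le> vs.dim (range (($) x))"
      by (rule pair.dim_image_le[OF lin])
    finally show ?thesis
      unfolding rk_eq_dim .
  qed
  moreover have "T (x - y) = T x - T y" for x y
    by (simp add: T_def vec_eq_iff \<phi>.diff)
  ultimately have
    "card (ball_inter r s (zero_outside I c)) \<le> card (ball_inter r s (T (zero_outside I c)))"
    by (intro card_ball_inter_le_image)
  \<comment> \<open>The permutation matches the zero positions too, and \<phi> fixes 0.\<close>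
  moreover have "\<sigma> j \<in> I \<longleftrightarrow> j \<in> J" for j
    using \<sigma> by (metis bij_is_inj inj_image_mem_iff)
  then have "T (zero_outside I c) = zero_outside J c'"
    by (auto simp: T_def vec_eq_iff \<phi>.zero \<phi> f)
  ultimately show ?thesis
    by simp
qed

text \<open>Entries of \<open>c\<close> outside \<open>I\<close> are combinations of those in
  \<open>I\<close> over the small field, so a shear that adds these combinations restores them from
  zeros.\<close>

lemma card_ball_inter_fill_dependent_coords:
  fixes c :: "'a ^ 'n"
  assumes I: "coords_independent \<iota> c I" and span: "range (($) c) \<subseteq> vs.span (($) c ` I)"
  shows "card (ball_inter r s (zero_outside I c)) \<le> card (ball_inter r s c)"
proof -
  have "\<exists>l. c $ i = (\<Sum>j\<in>I. \<iota> (l j) * c $ j)" for i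
  proof -
    have "c $ i \<in> vs.span (($) c ` I)"
      using span by auto
    then obtain u where "c $ i = (\<Sum>v\<in>($) c ` I. \<iota> (u v) * v)"
      by (auto simp: vs.span_finite)
    also have "\<dots> = (\<Sum>j\<in>I. \<iota> (u (c $ j)) * c $ j)"
      using I by (simp add: coords_independent_def sum.reindex)
    finally show ?thesis
      by (rule exI[of _ "\<lambda>j. u (c $ j)"])
  qed
  then obtain l where l: "\<And>i. c $ i = (\<Sum>j\<in>I. \<iota> (l i j) * c $ j)"
    by metis
  \<comment> \<open>Keeping the summand \<open>x $ i\<close> outside \<open>I\<close> makes
    \<open>T\<close> injective: the entries in \<open>I\<close> are unchanged, so the added sums can
    be subtracted again. On \<open>zero_outside I c\<close> that summand is 0, leaving exactly
    \<open>c $ i\<close>.\<close>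
  define T where
    "T x = (\<chi> i. if i \<in> I then x $ i else x $ i + (\<Sum>j\<in>I. \<iota> (l i j) * x $ j))" for x :: "'a ^ 'n"
  have "inj T"
  proof (rule injI)
    fix x y assume "T x = T y"
    then have eq: "T x $ i = T y $ i" for i
      by simp
    have on_I: "x $ i = y $ i" if "i \<in> I" for i
      using eq[of i] that by (simp add: T_def)
    moreover have "x $ i = y $ i" if "i \<notin> I" for i
      using eq[of i] that on_I by (simp add: T_def)
    ultimately show "x = y"
      by (metis vec_eq_iff)
  qed
  moreover have "rk \<iota> (T x) \<le> rk \<iota> x" for x
  proof (rule rk_mono_span)
    have "x $ i \<in> vs.span (range (($) x))" for i
      by (simp add: vs.span_base)
    then have "T x $ i \<in> vs.span (range (($) x))" for i
      by (simp add: T_def vs.span_add vs.span_sum vs.span_scale)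
    then show "range (($) (T x)) \<subseteq> vs.span (range (($) x))"
      by blast
  qed
  moreover have "T (x - y) = T x - T y" for x y
    by (simp add: T_def vec_eq_iff algebra_simps sum_subtractf)
  ultimately have
    "card (ball_inter r s (zero_outside I c)) \<le> card (ball_inter r s (T (zero_outside I c)))"
    by (intro card_ball_inter_le_image)
  moreover have "T (zero_outside I c) = c"
    by (simp add: T_def vec_eq_iff l[symmetric] cong: sum.cong)
  ultimately show ?thesis
    by simp
qed

section \<open>Comparison of two centres by their ranks\<close>

lemma card_ball_inter_antimono_rk:
  fixes c c' :: "'a ^ 'n"
  assumes "rk \<iota> c' \<le> rk \<iota> c"
  shows "card (ball_inter r s c) \<le> card (ball_inter r s c')"
proof -
  obtain I where I: "coords_independent \<iota> c I" "card I = rk \<iota> c"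
    using independent_coords_subset[of c] unfolding rk_eq_dim by metis
  obtain J where J: "coords_independent \<iota> c' J" "card J = rk \<iota> c'"
    "range (($) c') \<subseteq> vs.span (($) c' ` J)"
    using independent_coords_subset[of c'] unfolding rk_eq_dim by metis
  \<comment> \<open>The rank inequality enters here: enough independent entries of \<open>c\<close>
    are available to keep exactly as many as \<open>c'\<close> has.\<close>
  obtain I' where I': "I' \<subseteq> I" "card I' = card J"
    using obtain_subset_with_card_n[of "card J" I] assms I J by metis
  then have "coords_independent \<iota> c I'"
    using I(1) vs.independent_mono unfolding coords_independent_def
    by (meson image_mono inj_on_subset)
  have "card (ball_inter r s c) \<le> card (ball_inter r s (zero_outside I' c))"
    by (rule card_ball_inter_zero_outside)
  also have "\<dots> \<le> card (ball_inter r s (zero_outside J c'))"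
    by (rule card_ball_inter_independent_coords) fact+
  also have "\<dots> \<le> card (ball_inter r s c')"
    by (rule card_ball_inter_fill_dependent_coords) fact+
  finally show ?thesis .
qed

end

theorem proposition2:
  fixes \<iota> :: "'k::{field,finite} \<Rightarrow> 'a::{field,finite}"
    and q m n r s :: nat
    and c1 c2 c1' c2' :: "'a ^ 'n"
  assumes "primepow q" and "m > 0" and "n > 0"
    and "CARD('k) = q" and "CARD('a) = q ^ m" and "CARD('n) = n"
    and "field_embedding \<iota>"
    and "r \<le> n" and "s \<le> n"
    and "rank_dist \<iota> c1 c2 > rank_dist \<iota> c1' c2'"
  shows "card (rank_ball \<iota> r c1 \<inter> rank_ball \<iota> s c2)
       \<le> card (rank_ball \<iota> r c1' \<inter> rank_ball \<iota> s c2')"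
proof -
  interpret finite_field_extension \<iota>
    by unfold_locales fact
  show ?thesis
    unfolding card_rank_balls_inter
    using assms(10) by (intro card_ball_inter_antimono_rk) (simp add: rank_dist_def)
qed

end
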